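(* Let $d\geq 1$ be an integer and let $1\leq p,q \leq \infty$. Let $\Omega\subset\mathbb{R}^2$ be the pentagon with vertices $(1/2,1)$, $(1,1)$, $(1,1/2)$, $\big(3/4,\frac{\log_2 3}{2}-\frac{1}{4}\big)$ and $\big(\frac{\log_2 3}{2}-\frac{1}{4},3/4\big)$. If $(1/p,1/q)\in \Omega$, then the inequality $$\|f*g\|_{\ell^2(\mathbb{Z}^d)}\leq \|f\|_{\ell^p(\mathbb{Z}^d)}\,\|g\|_{\ell^q(\mathbb{Z}^d)}$$ holds for all $f,g:\mathbb{Z}^d\to \mathbb{R}$ supported in $\{0,1\}^d$. Moreover, if $\frac{1}{p}+\frac{1}{q}<\frac{\log_2 6}{2}$ or $\min\{1/p,1/q\}<1/2$, then this inequality does not hold for all such $f,g$ (i.e. it fails for some $f,g:\mathbb{Z}^d\to\mathbb{R}$ supported in $\{0,1\}^d$).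
   Context: A function $f:\mathbb{Z}^d\to\mathbb{R}$ is supported in $\{0,1\}^d$ if $f(x)=0$ for all $x\notin\{0,1\}^d$. Convolution: $(f*g)(x)=\sum_{y\in\mathbb{Z}^d} f(y)g(x-y)$. Norms: $\|f\|_{\ell^p(\mathbb{Z}^d)}=\big(\sum_{x\in\mathbb{Z}^d}|f(x)|^p\big)^{1/p}$ for $0<p<\infty$, and $\|f\|_{\ell^\infty(\mathbb{Z}^d)}=\sup_x|f(x)|$; the convention $1/\infty=0$ is used. The pentagon $\Omega$ is the convex hull of its five vertices. *)

theory Defs
  imports "HOL-Analysis.Analysis"
begin

text \<open>
  The lattice \<open>\<int>\<^sup>d\<close> is the type \<^typ>\<open>int ^ 'd\<close> with \<open>d = CARD('d) \<ge> 1\<close>.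
  A free type variable \<open>'d\<close> in a theorem thus quantifies over all \<open>d \<ge> 1\<close>.
\<close>

definition supported_in_cube :: "(int ^ 'd \<Rightarrow> real) \<Rightarrow> bool" where
  "supported_in_cube f \<longleftrightarrow> (\<forall>x. x \<notin> {x. \<forall>i. x $ i \<in> {0, 1}} \<longrightarrow> f x = 0)"

text \<open>
  The sums below are unordered infinite sums, which have the value \<open>0\<close> if they do not
  converge, and \<open>SUP\<close> on the reals is meaningful for bounded functions only. Neither matters
  for functions of finite support, in particular for functions supported in \<open>{0,1}\<^sup>d\<close>
  and their convolutions.
\<close>

definition conv :: "(int ^ 'd \<Rightarrow> real) \<Rightarrow> (int ^ 'd \<Rightarrow> real) \<Rightarrow> int ^ 'd \<Rightarrow> real" where
  "conv f g x = (\<Sum>\<^sub>\<infinity>y. f y * g (x - y))"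

text \<open>Intended for \<open>0 < p \<le> \<infinity>\<close>.\<close>

definition lp_norm :: "ennreal \<Rightarrow> (int ^ 'd \<Rightarrow> real) \<Rightarrow> real" where
  "lp_norm p f =
    (if p = \<infinity> then SUP x. \<bar>f x\<bar>
     else (\<Sum>\<^sub>\<infinity>x. \<bar>f x\<bar> powr enn2real p) powr (1 / enn2real p))"

definition pentagon :: "(real \<times> real) set" where
  "pentagon = convex hull
    {(1/2, 1), (1, 1), (1, 1/2), (3/4, log 2 3 / 2 - 1/4), (log 2 3 / 2 - 1/4, 3/4)}"

text \<open>In \<^typ>\<open>ennreal\<close>, \<open>1 / \<infinity> = 0\<close>.\<close>

definition recip :: "ennreal \<Rightarrow> real" where
  "recip p = enn2real (1 / p)"

end

theory Submission
  imports Defs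
begin

text \<open>
  Write \<open>s = 1/p\<close> and \<open>t = 1/q\<close>. The inequality tensorizes: splitting \<open>f\<close> and \<open>g\<close> according to
  one coordinate, \<open>f * g\<close> decomposes into pieces with disjoint supports,
  \<open>f\<^sub>0 * g\<^sub>0\<close>, \<open>f\<^sub>0 * g\<^sub>1 + f\<^sub>1 * g\<^sub>0\<close> and \<open>f\<^sub>1 * g\<^sub>1\<close>. By induction and the triangle inequality in
  \<open>\<ell>\<^sup>2\<close>, the inequality in any dimension follows from the one in dimension one, applied to the
  norms of these halves (\<open>L2_set_conv_on_subcube_le\<close>). In dimension one, after the
  substitution \<open>f = (x\<^sup>s, y\<^sup>s)\<close>, \<open>g = (u\<^sup>t, v\<^sup>t)\<close> with \<open>x + y = u + v = 1\<close>, it reads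
  \<open>(x\<^bsup>2s\<^esup> + y\<^bsup>2s\<^esup>) (u\<^bsup>2t\<^esup> + v\<^bsup>2t\<^esup>) + 2 (x y)\<^sup>s (u v)\<^sup>t \<le> 1\<close>. For fixed \<open>x, y, u, v\<close> the left-hand side
  is a sum of exponentials of linear functions of \<open>(s, t)\<close>, hence convex, so that it only
  has to be bounded at the vertices of the pentagon.

  The vertices with coordinates in \<open>{1/2, 1}\<close> are elementary, and the last two are exchanged by
  the symmetry between \<open>f\<close> and \<open>g\<close>. At \<open>s = 3/4\<close>, put \<open>\<sigma> = (x y)\<^bsup>1/4\<^esup>\<close>,
  \<open>U = u\<^bsup>2t\<^esup> + v\<^bsup>2t\<^esup>\<close> and \<open>V = (u v)\<^sup>t\<close>. Since \<open>x\<^bsup>3/2\<^esup> + y\<^bsup>3/2\<^esup> = (1 - \<sigma>\<^sup>2) sqrt (1 + 2 \<sigma>\<^sup>2)\<close>, the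
  maximum over \<open>x\<close> can be computed (\<open>quadratic_optimization\<close>), and what remains is
  \<open>(U\<^sup>2 - V\<^sup>2)\<^sup>2 \<le> U\<^sup>2 - 2 V\<^sup>2\<close>, an inequality in the ratio \<open>v / u\<close> alone. It is an equality at the
  ratios \<open>0\<close> and \<open>1\<close> for \<open>t = log\<^sub>2 3 / 2 - 1/4\<close>, and a count of the sign changes of two
  successive derivatives proves it in between (\<open>one_variable_inequality\<close>).

  The counterexamples are \<open>f = g\<close> the indicator of the cube, where
  \<open>\<parallel>f * f\<parallel>\<^sub>2 = 6\<^bsup>d/2\<^esup>\<close> and the right-hand side is \<open>2\<^bsup>d(s + t)\<^esup>\<close>, and the indicator of the cube
  together with the unit mass at the origin, where the two sides are \<open>2\<^bsup>d/2\<^esup>\<close> and \<open>2\<^bsup>ds\<^esup>\<close> or,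
  with the roles exchanged, \<open>2\<^bsup>dt\<^esup>\<close>.
\<close>

section \<open>An inequality in one variable\<close>

text \<open>
  If \<open>f'\<close> never becomes positive after having been negative, then \<open>f\<close> first increases and then
  decreases, so that its minimum on the interval is attained at an end point.
\<close>

lemma nonneg_of_single_sign_change:
  fixes f f' :: "real \<Rightarrow> real"
  assumes cont: "continuous_on {a..b} f"
    and der: "\<And>x. a < x \<Longrightarrow> x < b \<Longrightarrow> (f has_real_derivative f' x) (at x)"
    and ends: "0 \<le> f a" "0 \<le> f b"
    and sign: "\<And>c d. a < c \<Longrightarrow> c < d \<Longrightarrow> d < b \<Longrightarrow> f' c < 0 \<Longrightarrow> f' d \<le> 0"
    and x: "a \<le> x" "x \<le> b"
  shows "0 \<le> f x"
proof (rule ccontr)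
  assume "\<not> 0 \<le> f x"
  then have neg: "f x < 0" by simp
  with ends x have ax: "a < x" and xb: "x < b" by (auto simp: order.order_iff_strict)
  obtain l c where c: "a < c" "c < x" "DERIV f c :> l" "f x - f a = (x - a) * l"
  proof -
    have "continuous_on {a..x} f" using cont by (rule continuous_on_subset) (use xb in auto)
    moreover have "f differentiable at y" if "a < y" "y < x" for y
      using der[of y] that xb real_differentiable_def by fastforce
    ultimately show ?thesis using MVT[OF ax] that by blast
  qed
  obtain m d where d: "x < d" "d < b" "DERIV f d :> m" "f b - f x = (b - x) * m"
  proof -
    have "continuous_on {x..b} f" using cont by (rule continuous_on_subset) (use ax in auto)
    moreover have "f differentiable at y" if "x < y" "y < b" for y
      using der[of y] that ax real_differentiable_def by fastforce
    ultimately show ?thesis using MVT[OF xb] that by blast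
  qed
  have "l = f' c" "m = f' d" using der c d ax xb by (meson DERIV_unique less_trans)+
  moreover have "l < 0"
  proof -
    have "(x - a) * l < 0" using c(4) neg ends by linarith
    then show ?thesis using ax by (simp add: mult_less_0_iff)
  qed
  moreover have "m > 0"
  proof -
    have "(b - x) * m > 0" using d(4) neg ends by linarith
    then show ?thesis using xb by (simp add: zero_less_mult_iff)
  qed
  ultimately show False using sign[of c d] c d ax xb by simp
qed

lemma log23_bounds: "3/2 < log 2 (3::real)" "log 2 (3::real) < 2"
proof -
  have "(2::real) powr (3/2) < 3"
  proof -
    have "((2::real) powr (3/2))^2 = 2 powr 3" by (simp add: powr_realpow[symmetric] powr_powr)
    also have "\<dots> < 3^2" by simp
    finally show ?thesis using power_less_imp_less_base by fastforce
  qed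
  then show "3/2 < log 2 (3::real)" using less_log_iff[of 2 3 "3/2"] by simp
  show "log 2 (3::real) < 2" by (simp add: log_less_iff)
qed

text \<open>
  The function \<open>J\<close> vanishes at \<open>1\<close>. Up to a positive factor its derivative is a palindromic
  polynomial of degree \<open>6\<close>, hence a cubic polynomial in \<open>w = x + 1/x \<ge> 2\<close>. That cubic increases,
  while \<open>w\<close> decreases in \<open>x\<close>. So \<open>J'\<close> cannot be negative first and positive later, which would
  be necessary for \<open>J\<close> to fall from a positive to a negative value before returning to
  \<open>J 1 = 0\<close>.
\<close>

lemma log_ratio_sign_change:
  fixes e a b :: real
  defines "J \<equiv> \<lambda>x. ln (1 + x + x^3) - ln (1 + x^2 + x^3) + e * ln x"
  assumes e: "0 < e" "e < 1/3" and ab: "0 < a" "a < b" "b < 1" and Ja: "0 < J a"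
  shows "0 \<le> J b"
proof (rule ccontr)
  assume nb: "\<not> 0 \<le> J b"
  define P where "P \<equiv> \<lambda>w::real. e*w^3 + (1+e)*w^2 - (2+2*e)*w + e - 3"
  define D where "D \<equiv> \<lambda>x::real. (1 + x + x^3) * (1 + x^2 + x^3)"
  define J' where "J' \<equiv> \<lambda>x::real. x^2 * P (x + 1/x) / D x"
  have Dpos: "0 < D x" if "0 < x" for x using that unfolding D_def by (simp add: add_pos_pos)
  have der: "(J has_real_derivative J' x) (at x)" if "0 < x" for x
  proof -
    have pos: "0 < 1 + x + x^3" "0 < 1 + x^2 + x^3" using that by (simp_all add: add_pos_pos)
    have "(J has_real_derivative
       ((1 + 3*x^2) / (1 + x + x^3) - (2*x + 3*x^2) / (1 + x^2 + x^3) + e / x)) (at x)"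
      unfolding J_def using that pos
      by (auto intro!: derivative_eq_intros simp: divide_simps)
    also have "(1 + 3*x^2) / (1 + x + x^3) - (2*x + 3*x^2) / (1 + x^2 + x^3) + e / x = J' x"
    proof -
      have "x^3 * P (x + 1/x) = e * D x + x * (1 - 2*x - x^2 - 2*x^3 + x^4)"
        unfolding P_def D_def using that by (simp add: field_simps) algebra
      moreover have "J' x = x^3 * P (x + 1/x) / (x * D x)"
        unfolding J'_def using that by (simp add: power2_eq_square power3_eq_cube)
      ultimately have "J' x = (e * D x + x * (1 - 2*x - x^2 - 2*x^3 + x^4)) / (x * D x)"
        by simp
      also have "\<dots> = (1 + 3*x^2) / (1 + x + x^3) - (2*x + 3*x^2) / (1 + x^2 + x^3) + e / x"
        unfolding D_def using that pos by (simp add: divide_simps) algebra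
      finally show ?thesis by simp
    qed
    finally show ?thesis .
  qed
  have Pmono: "P v < P w" if "2 \<le> v" "v < w" for v w
  proof -
    have "P w - P v = (w - v) * (e * (w^2 + v * w + v^2) + (1+e) * (w + v - 2))"
      unfolding P_def by algebra
    also have "\<dots> > 0" using that e by (intro mult_pos_pos add_nonneg_pos) auto
    finally show ?thesis by simp
  qed
  obtain c where c: "a < c" "c < b" "J b - J a = (b - a) * J' c"
    using MVT2[of a b J J'] der ab by auto
  obtain d where d: "b < d" "d < 1" "J 1 - J b = (1 - b) * J' d"
    using MVT2[of b 1 J J'] der ab by auto
  have "J 1 = 0" by (simp add: J_def)
  have "(b - a) * J' c < 0" using c Ja nb by linarith
  then have "J' c < 0" using ab by (simp add: mult_less_0_iff)
  then have Pc: "P (c + 1/c) < 0" using Dpos[of c] ab c by (auto simp: J'_def divide_less_0_iff mult_less_0_iff)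
  have "(1 - b) * J' d > 0" using d nb \<open>J 1 = 0\<close> by linarith
  then have "J' d > 0" using ab by (simp add: zero_less_mult_iff)
  then have Pd: "P (d + 1/d) > 0" using Dpos[of d] ab d by (auto simp: J'_def zero_less_divide_iff zero_less_mult_iff)
  have cd: "0 < c" "c < d" "d < 1" using ab c d by auto
  have "d + 1/d < c + 1/c"
  proof -
    have "c + 1/c - (d + 1/d) = (d - c) * (1 - c*d) / (c*d)" using cd by (simp add: field_simps)
    also have "\<dots> > 0" using cd mult_strict_mono[of c 1 d 1] by (intro divide_pos_pos mult_pos_pos) auto
    finally show ?thesis by simp
  qed
  moreover have "2 \<le> d + 1/d"
  proof -
    have "d + 1/d - 2 = (d-1)^2 / d" using cd by (simp add: field_simps power2_eq_square)
    also have "\<dots> \<ge> 0" using cd by simp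
    finally show ?thesis by simp
  qed
  ultimately show False using Pmono Pc Pd by fastforce
qed

text \<open>
  The difference \<open>K\<close> of the two sides vanishes at \<open>0\<close> and at \<open>1\<close>; the latter determines \<open>k\<close>. The
  sign of \<open>K'\<close> is opposite to that of the function \<open>J\<close> of the previous lemma with
  \<open>e = 1 - 1/k\<close>, where \<open>0 < e < 1/3\<close> because \<open>1 < k < 3/2\<close>.
\<close>

lemma one_variable_inequality:
  fixes k x :: real
  assumes k: "k = log 2 3 - 1/2" and x: "0 \<le> x" "x \<le> 1"
  shows "2 * ln (1 + x + x^2) \<le> ln (1 + x^2) + 2 * k * ln (1 + x powr (1/k))"
proof -
  define K where "K \<equiv> \<lambda>x. 2 * k * ln (1 + x powr (1/k)) - 2 * ln (1 + x + x^2) + ln (1 + x^2)"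
  define K' where "K' \<equiv> \<lambda>x. 2 * (x powr (1/k) * (1 + x^2 + x^3) - (x + x^2 + x^4))
      / (x * (1 + x powr (1/k)) * (1 + x + x^2) * (1 + x^2))"
  have k12: "1 < k" "k < 3/2" using log23_bounds k by auto
  have der: "(K has_real_derivative K' y) (at y)" if "0 < y" for y
  proof -
    define r where "r = y powr (1/k)"
    have r: "0 < r" using that by (simp add: r_def)
    have pos: "0 < 1 + y + y^2" "0 < 1 + y^2" "1 + r \<noteq> 0" using that r by (simp_all add: add_pos_pos)
    have "y powr (1/k - 1) = r / y" using that by (simp add: r_def powr_diff)
    moreover have "(K has_real_derivative
       (2 * k * ((1/k) * y powr (1/k - 1) / (1 + r)) - 2 * ((1 + 2*y) / (1 + y + y^2)) + 2*y / (1 + y^2))) (at y)"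
      unfolding K_def r_def using that pos k12
      by (auto intro!: derivative_eq_intros simp: add_pos_pos)
    moreover have "2 * k * ((1/k) * (r/y) / (1 + r)) - 2 * ((1 + 2*y) / (1 + y + y^2)) + 2*y / (1 + y^2) = K' y"
    proof -
      have *: "2 * k * ((1/k) * (r/y) / (1 + r)) = 2 * (r/y) / (1+r)" using k12 by simp
      show ?thesis unfolding * K'_def r_def[symmetric] using that pos by (simp add: divide_simps) algebra
    qed
    ultimately show ?thesis by simp
  qed
  have sgn: "K' y < 0 \<longleftrightarrow> 0 < ln (1 + y + y^3) - ln (1 + y^2 + y^3) + (1 - 1/k) * ln y"
            "0 < K' y \<longleftrightarrow> ln (1 + y + y^3) - ln (1 + y^2 + y^3) + (1 - 1/k) * ln y < 0"
    if "0 < y" for y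
  proof -
    define r where "r = y powr (1/k)"
    have r: "0 < r" using that by (simp add: r_def)
    have pos: "0 < 1 + y + y^3" "0 < 1 + y^2 + y^3" using that by (simp_all add: add_pos_pos)
    have "0 < y * (1 + r) * (1 + y + y^2) * (1 + y^2)"
      using that r by (simp add: add_pos_pos)
    then have 1: "K' y < 0 \<longleftrightarrow> r * (1 + y^2 + y^3) < y * (1 + y + y^3)"
                 "0 < K' y \<longleftrightarrow> y * (1 + y + y^3) < r * (1 + y^2 + y^3)"
      unfolding K'_def r_def[symmetric]
      by (simp_all add: divide_less_0_iff zero_less_divide_iff) (auto simp: algebra_simps eval_nat_numeral)
    have 2: "ln (r * (1 + y^2 + y^3)) = ln y / k + ln (1 + y^2 + y^3)"
      using that r pos by (simp add: ln_mult r_def ln_powr)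
    have 3: "ln (y * (1 + y + y^3)) = ln y + ln (1 + y + y^3)"
      using that pos by (simp add: ln_mult)
    have m: "0 < r * (1 + y^2 + y^3)" "0 < y * (1 + y + y^3)" using that r pos by simp_all
    show "K' y < 0 \<longleftrightarrow> 0 < ln (1 + y + y^3) - ln (1 + y^2 + y^3) + (1 - 1/k) * ln y"
      unfolding 1 ln_less_cancel_iff[OF m, symmetric] 2 3 by (simp add: algebra_simps)
    show "0 < K' y \<longleftrightarrow> ln (1 + y + y^3) - ln (1 + y^2 + y^3) + (1 - 1/k) * ln y < 0"
      unfolding 1 ln_less_cancel_iff[OF m(2,1), symmetric] 2 3 by (simp add: algebra_simps)
  qed
  have "0 \<le> K x"
  proof (rule nonneg_of_single_sign_change[where f = K and f' = K' and a = 0 and b = 1])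
    have "1 + y powr (1/k) \<noteq> 0" "1 + y + y^2 \<noteq> 0" "1 + y^2 \<noteq> 0" if "0 \<le> y" for y
    proof -
      have "0 \<le> y powr (1/k)" "0 \<le> y^2" by simp_all
      then show "1 + y powr (1/k) \<noteq> 0" "1 + y + y^2 \<noteq> 0" "1 + y^2 \<noteq> 0" using that by linarith+
    qed
    then show "continuous_on {0..1} K" unfolding K_def using k12
      by (auto intro!: continuous_intros continuous_on_powr')
    show "0 \<le> K 0" by (simp add: K_def)
    have "2 * k * ln 2 = 2 * ln 3 - ln 2" by (simp add: k log_def field_simps)
    then show "0 \<le> K 1" by (simp add: K_def)
    show "K' d \<le> 0" if "0 < c" "c < d" "d < 1" "K' c < 0" for c d
      using log_ratio_sign_change[of "1 - 1/k" c d] that sgn(1)[of c] sgn(2)[of d] k12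
      by (fastforce simp: field_simps not_less[symmetric])
  qed (use der x in auto)
  then show ?thesis by (simp add: K_def)
qed

text \<open>
  Let \<open>c\<close> and \<open>w\<close> be the nonnegative roots. For fixed \<open>z\<close>, equality holds at \<open>s = z\<close> if this value is
  admissible, and it maximizes the left-hand side; hence the factor \<open>(z - s)\<^sup>2\<close> in the proof.
\<close>

lemma quadratic_optimization:
  fixes s c z w :: real
  assumes s0: "0 \<le> s" and s2: "2 * s^2 \<le> 1" and z0: "0 \<le> z"
    and c: "c^2 = 1 + 2 * s^2" and w: "w^2 = 1 + 2 * z^2"
  shows "c * (1 - s^2) * w + 2 * s^3 * z \<le> 1 + z^2"
proof -
  have s1: "s \<le> 1" by (rule power2_le_imp_le) (use s2 in simp_all)
  have "0 \<le> (z - s)^2 * (z^2 + 2 * s * (1 - 2 * s^2) * z + s^2 * (1 + 2 * (1 - s^2)))"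
  proof -
    have "0 \<le> 2 * s * (1 - 2 * s^2) * z" using s0 s2 z0 by simp
    moreover have "0 \<le> s^2 * (1 + 2 * (1 - s^2))" using s2 by (intro mult_nonneg_nonneg) auto
    ultimately show ?thesis by simp
  qed
  also have "\<dots> = (1 + z^2 - 2 * s^3 * z)^2 - (1 + 2 * s^2) * (1 - s^2)^2 * (1 + 2 * z^2)"
    by (simp add: algebra_simps power2_eq_square power3_eq_cube)
  also have "(1 + 2 * s^2) * (1 - s^2)^2 * (1 + 2 * z^2) = (c * (1 - s^2) * w)^2"
    unfolding c[symmetric] w[symmetric] by (simp add: power_mult_distrib)
  finally have "(c * (1 - s^2) * w)^2 \<le> (1 + z^2 - 2 * s^3 * z)^2" by simp
  moreover have "0 \<le> 1 + z^2 - 2 * s^3 * z"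
  proof -
    have "s^3 \<le> 1" using s1 s0 by (simp add: power_le_one)
    then have "s^3 * z \<le> 1 * z" using z0 by (intro mult_right_mono) auto
    moreover have "0 \<le> (1 - z)^2" by simp
    ultimately show ?thesis by (simp add: power2_eq_square algebra_simps)
  qed
  ultimately have "c * (1 - s^2) * w \<le> 1 + z^2 - 2 * s^3 * z" by (rule power2_le_imp_le)
  then show ?thesis by simp
qed

lemma powr_double: "x powr (2 * a) = (x powr a)^2" for x a :: real
  using powr_add[of x a a] by (simp add: power2_eq_square)

lemma one_variable_inequality_homogeneous:
  fixes k u v :: real
  assumes k: "k = log 2 3 - 1/2" and "0 < u" "0 < v" "u + v = 1"
  shows "(u powr (2*k) + (u * v) powr k + v powr (2*k))^2 \<le> u powr (2*k) + v powr (2*k)"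
  using assms(2-)
proof (induction u v rule: linorder_wlog)
  case (le v u)
  \<comment> \<open>By symmetry \<open>v \<le> u\<close>. Both sides are compared after division by powers of \<open>u\<close>.\<close>
  define x where "x = (v / u) powr k"
  have k1: "1 < k" using log23_bounds k by simp
  have x: "0 < x" "x \<le> 1" using le k1 by (auto simp: x_def intro!: powr_le1)
  have v: "v powr k = x * u powr k" using le by (simp add: x_def powr_divide)
  have v2: "v powr (2*k) = x^2 * u powr (2*k)"
    by (simp add: powr_double v power_mult_distrib)
  have vu: "(v * u) powr k = x * u powr (2*k)"
    using v le by (simp add: powr_mult powr_double power2_eq_square)
  have root: "x powr (1/k) = v / u" using le k1 by (simp add: x_def powr_powr)
  have "1 + v / u = 1 / u" using le by (simp add: field_simps)
  then have "2 * ln (1 + x + x^2) \<le> ln (1 + x^2) + 2 * k * ln (1 / u)"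
    using one_variable_inequality[OF k, of x] x root by simp
  then have "ln ((1 + x + x^2)^2) \<le> ln ((1 + x^2) * (1 / u) powr (2*k))"
    using x le by (simp add: ln_mult ln_realpow add_pos_pos)
  then have "(1 + x + x^2)^2 \<le> (1 + x^2) * (1 / u) powr (2*k)"
  proof (rule ln_le_cancel_iff[THEN iffD1, rotated 2])
    have "0 < 1 + x + x^2" "0 < 1 + x^2" using x by (simp_all add: add_pos_pos)
    then show "0 < (1 + x + x^2)^2" "0 < (1 + x^2) * (1 / u) powr (2*k)" using le by auto
  qed
  then have "(1 + x + x^2)^2 * (u powr (2*k))^2 \<le> (1 + x^2) * (1 / u) powr (2*k) * (u powr (2*k))^2"
    by (rule mult_right_mono) simp
  also have "\<dots> = (1 + x^2) * u powr (2*k)"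
    using le by (simp add: powr_divide power2_eq_square)
  finally have "((1 + x + x^2) * u powr (2*k))^2 \<le> (1 + x^2) * u powr (2*k)"
    by (simp add: power_mult_distrib)
  moreover have "(1 + x + x^2) * u powr (2*k) = v powr (2*k) + (v * u) powr k + u powr (2*k)"
    by (simp add: v2 vu distrib_right)
  moreover have "(1 + x^2) * u powr (2*k) = v powr (2*k) + u powr (2*k)"
    by (simp add: v2 distrib_right)
  ultimately show ?case by simp
next
  case (sym v u)
  then show ?case by (simp only: add.commute mult.commute add.left_commute)
qed

section \<open>The inequality in dimension one\<close>

text \<open>
  The square of \<open>\<parallel>f * g\<parallel>\<^sub>2\<close> in dimension one for \<open>f = (x\<^sup>s, y\<^sup>s)\<close> and \<open>g = (u\<^sup>t, v\<^sup>t)\<close>, as a function of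
  the pair of exponents \<open>(s, t)\<close>. The norms on the right-hand side of the inequality are
  then \<open>(x + y)\<^sup>s\<close> and \<open>(u + v)\<^sup>t\<close>.
\<close>

definition two_point_form :: "real \<Rightarrow> real \<Rightarrow> real \<Rightarrow> real \<Rightarrow> real \<times> real \<Rightarrow> real" where
  "two_point_form x y u v = (\<lambda>(s, t).
     (x powr (2* s) + y powr (2* s)) * (u powr (2*t) + v powr (2*t)) + 2 * (x * y) powr s * (u * v) powr t)"

lemma two_point_form_swap: "two_point_form x y u v (s, t) = two_point_form u v x y (t, s)"
  by (simp add: two_point_form_def algebra_simps)

lemma two_point_form_vertex:
  assumes "0 < x" "0 < y" "x + y = 1" "0 < u" "0 < v" "u + v = 1"
  shows "two_point_form x y u v (3/4, log 2 3 / 2 - 1/4) \<le> 1"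
proof -
  define k where "k = log 2 (3::real) - 1/2"
  define X Y where "X = sqrt x" and "Y = sqrt y"
  define s where "s = sqrt (X * Y)"
  define U V where "U = u powr k + v powr k" and "V = (u * v) powr (k/2)"
  define Q where "Q = sqrt (U^2 - 2 * V^2)"
  have pos: "0 < X" "0 < Y" "X^2 = x" "Y^2 = y" using assms by (simp_all add: X_def Y_def)
  have s2: "s^2 = X * Y" and s0: "0 \<le> s" using pos by (simp_all add: s_def)
  have V2: "V^2 = (u * v) powr k" by (simp add: V_def flip: powr_double)
  have U2: "U^2 = u powr (2*k) + v powr (2*k) + 2 * (u * v) powr k"
    using assms by (simp add: U_def powr_mult powr_double power2_sum)
  have Qpos: "0 < Q" using assms by (simp add: Q_def U2 V2 add_pos_pos)
  have Q2: "Q^2 = u powr (2*k) + v powr (2*k)" by (simp add: Q_def U2 V2)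
  \<comment> \<open>Here \<open>Q\<^sup>2 + V\<^sup>2 = U\<^sup>2 - V\<^sup>2\<close>.\<close>
  have "(Q^2 + V^2)^2 \<le> Q^2"
    unfolding Q2 V2 using one_variable_inequality_homogeneous[OF k_def assms(4-6)]
    by (simp add: algebra_simps)
  then have Q3: "Q^2 + V^2 \<le> Q" using Qpos by (intro power2_le_imp_le[of "Q^2 + V^2" Q]) auto
  have UQ: "(U / Q)^2 = 1 + 2 * (V / Q)^2"
  proof -
    have "U^2 = Q^2 + 2 * V^2" by (simp add: Q2 U2 V2)
    then show ?thesis using Qpos by (simp add: power_divide add_divide_distrib)
  qed
  \<comment> \<open>Dividing by \<open>Q\<close> normalizes \<open>U\<^sup>2 - 2 V\<^sup>2\<close> to \<open>1\<close>; similarly \<open>(X + Y)\<^sup>2 - 2 s\<^sup>2 = x + y = 1\<close>.\<close>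
  have quad: "(X + Y) * (1 - s^2) * (U / Q) + 2 * s^3 * (V / Q) \<le> 1 + (V / Q)^2"
  proof (rule quadratic_optimization)
    have "0 \<le> (X - Y)^2" by simp
    then show "2 * s^2 \<le> 1" using pos assms(3) by (simp add: s2 power2_diff)
    show "(X + Y)^2 = 1 + 2 * s^2" using pos assms(3) by (simp add: s2 power2_sum)
    show "(U / Q)^2 = 1 + 2 * (V / Q)^2" by (rule UQ)
  qed (use s0 Qpos in \<open>auto simp: V_def\<close>)
  have "Q * ((X + Y) * (1 - s^2) * (U / Q) + 2 * s^3 * (V / Q)) \<le> Q * (1 + (V / Q)^2)"
    using quad Qpos by (intro mult_left_mono) auto
  also have "Q * (1 + (V / Q)^2) = (Q^2 + V^2) / Q" using Qpos by (simp add: field_simps power2_eq_square)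
  also have "\<dots> \<le> 1" using Q3 Qpos by simp
  finally have fin: "(X + Y) * (1 - s^2) * U + 2 * s^3 * V \<le> 1" using Qpos by (simp add: distrib_left)
  have "x powr (3/2) = X^3" "y powr (3/2) = Y^3"
    using assms by (simp_all add: X_def Y_def powr_half_sqrt[symmetric] powr_realpow[symmetric] powr_powr)
  moreover have "X^3 + Y^3 = (X + Y) * (1 - s^2)"
  proof -
    have "X^2 + Y^2 = 1" using pos assms(3) by simp
    then have "(X + Y) * (1 - s^2) = (X + Y) * (X^2 + Y^2 - X * Y)" by (simp add: s2)
    also have "\<dots> = X^3 + Y^3" by algebra
    finally show ?thesis by simp
  qed
  moreover have "(x * y) powr (3/4) = s^3"
    using assms by (simp add: s_def X_def Y_def powr_mult powr_half_sqrt[symmetric] powr_realpow[symmetric] powr_powr)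
  moreover have t: "log 2 3 / 2 - 1/4 = k / 2" by (simp add: k_def)
  ultimately show ?thesis using fin unfolding two_point_form_def t U_def V_def by simp
qed

lemma two_point_form_Young:
  assumes "0 < x" "0 < y" "x + y = 1" "0 < u" "0 < v" "u + v = 1"
  shows "two_point_form x y u v (1/2, 1) \<le> 1" "two_point_form x y u v (1, 1) \<le> 1"
proof -
  have "sqrt (x * y) \<le> 1/2"
    using arith_geo_mean_sqrt[of x y] assms by simp
  then have "2 * sqrt (x * y) * (u * v) \<le> 2 * (u * v)"
    by (intro mult_right_mono, linarith) (use assms in auto)
  then have "u^2 + v^2 + 2 * sqrt (x * y) * (u * v) \<le> u^2 + v^2 + 2 * (u * v)" by (rule add_left_mono)
  moreover have "u^2 + v^2 + 2 * (u * v) = 1" using assms(6) power2_sum[of u v] by simp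
  moreover have "0 \<le> u * v" using assms by simp
  ultimately show "two_point_form x y u v (1/2, 1) \<le> 1"
    using assms unfolding two_point_form_def by (simp add: powr_half_sqrt)
  have xy: "x^2 + y^2 + 2 * (x * y) = 1" using assms(3) power2_sum[of x y] by simp
  have "(x^2 + y^2) * (u^2 + v^2) + 2 * (x * y) * (u * v) \<le> (x^2 + y^2 + 2 * (x * y)) * (u^2 + v^2 + 2 * (u * v))"
    using assms by (simp add: algebra_simps)
  also have "\<dots> = 1" using xy \<open>u^2 + v^2 + 2 * (u * v) = 1\<close> by simp
  finally show "two_point_form x y u v (1, 1) \<le> 1"
    using assms by (simp add: two_point_form_def)
qed

lemma convex_on_exp_linear: "convex_on UNIV (\<lambda>(s, t). exp (a * s + b * t :: real))"
proof -
  have "exp (a * (l * s + m * s') + b * (l * t + m * t')) \<le> l * exp (a * s + b * t) + m * exp (a * s' + b * t')"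
    if "0 \<le> l" "0 \<le> m" "l + m = 1" for l m s t s' t' :: real
  proof -
    have "exp (l * (a * s + b * t) + m * (a * s' + b * t')) \<le> l * exp (a * s + b * t) + m * exp (a * s' + b * t')"
      using convex_onD[OF exp_convex, of m "a * s + b * t" "a * s' + b * t'"] that
      by (simp add: eq_diff_eq[symmetric])
    then show ?thesis by (simp add: algebra_simps)
  qed
  then show ?thesis unfolding convex_on_def by auto
qed

lemma convex_on_two_point_form:
  assumes "0 < x" "0 < y" "0 < u" "0 < v"
  shows "convex_on UNIV (two_point_form x y u v)"
proof -
  let ?e = "\<lambda>a b (s :: real, t :: real). exp (a * s + b * t :: real)"
  have "two_point_form x y u v = (\<lambda>p. ?e (2 * ln x) (2 * ln u) p + ?e (2 * ln x) (2 * ln v) p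
      + ?e (2 * ln y) (2 * ln u) p + ?e (2 * ln y) (2 * ln v) p
      + (?e (ln (x * y)) (ln (u * v)) p + ?e (ln (x * y)) (ln (u * v)) p))"
    using assms by (auto simp: fun_eq_iff two_point_form_def powr_def exp_add algebra_simps)
  then show ?thesis by (simp only:) (intro convex_on_add convex_on_exp_linear)
qed

lemma two_point_form_pentagon:
  assumes "0 < x" "0 < y" "x + y = 1" "0 < u" "0 < v" "u + v = 1" "p \<in> pentagon"
  shows "two_point_form x y u v p \<le> 1"
proof -
  let ?S = "{p. two_point_form x y u v p \<le> 1}"
  have "convex ?S"
  proof (rule convexI)
    fix p q :: "real \<times> real" and l m :: real
    assume *: "p \<in> ?S" "q \<in> ?S" "0 \<le> l" "0 \<le> m" "l + m = 1"
    have "two_point_form x y u v (l *\<^sub>R p + m *\<^sub>R q)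
        \<le> l * two_point_form x y u v p + m * two_point_form x y u v q"
      using convex_on_two_point_form[OF assms(1,2,4,5)] * unfolding convex_on_def by blast
    also have "\<dots> \<le> 1" using * by (intro convex_bound_le) auto
    finally show "l *\<^sub>R p + m *\<^sub>R q \<in> ?S" by simp
  qed
  moreover have "{(1/2, 1), (1, 1), (1, 1/2), (3/4, log 2 3 / 2 - 1/4), (log 2 3 / 2 - 1/4, 3/4)} \<subseteq> ?S"
    using two_point_form_vertex[of x y u v] two_point_form_vertex[of u v x y]
      two_point_form_Young[of x y u v] two_point_form_Young[of u v x y] assms
    by (simp add: two_point_form_swap[of x y u v])
  ultimately have "pentagon \<subseteq> ?S" unfolding pentagon_def by (rule hull_minimal[rotated])
  then show ?thesis using assms by auto
qed

lemma pentagon_ge_half: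
  assumes "(s, t) \<in> pentagon"
  shows "1/2 \<le> s" "1/2 \<le> t"
proof -
  have "pentagon \<subseteq> {1/2..} \<times> {1/2..}"
    unfolding pentagon_def
  proof (rule hull_minimal)
    show "convex ({1/2..} \<times> {1/2..} :: (real \<times> real) set)"
      by (intro convex_Times convex_real_interval)
  qed (use log23_bounds in auto)
  then show "1/2 \<le> s" "1/2 \<le> t" using assms by auto
qed

text \<open>
  The norm of \<open>\<ell>\<^sup>p\<close> dominates that of \<open>\<ell>\<^sup>2\<close> for \<open>p = 1/t \<le> 2\<close>. This covers the degenerate cases of the
  inequality in dimension one, in which one of the four entries is zero and
  logarithms are not available.
\<close>

lemma square_sum_le:
  fixes t a b :: real
  assumes "1/2 \<le> t" "0 \<le> a" "0 \<le> b"
  shows "a^2 + b^2 \<le> ((a powr (1/t) + b powr (1/t)) powr t)^2"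
proof -
  define S where "S = a powr (1/t) + b powr (1/t)"
  have sq: "c^2 \<le> c powr (1/t) / S * (S powr t)^2" if "0 \<le> c" "c powr (1/t) \<le> S" for c
  proof (cases "c = 0")
    case False
    then have "0 < c powr (1/t)" by simp
    with that have S: "0 < c powr (1/t)" "0 < S" by linarith+
    have "c^2 = (c powr (1/t)) powr (2*t)"
      using False that assms by (simp add: powr_powr)
    also have "\<dots> = (c powr (1/t) / S) powr (2*t) * S powr (2*t)"
      using S by (simp add: powr_divide)
    also have "\<dots> \<le> c powr (1/t) / S * S powr (2*t)"
      using assms S that by (intro mult_right_mono powr_le_one_le) auto
    also have "S powr (2*t) = (S powr t)^2" by (rule powr_double)
    finally show ?thesis .
  qed simp
  show ?thesis
  proof (cases "S = 0")
    case True
    then have "a = 0" "b = 0" by (auto simp: S_def add_nonneg_eq_0_iff)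
    then show ?thesis by simp
  next
    case False
    have "a^2 + b^2 \<le> (a powr (1/t) / S + b powr (1/t) / S) * (S powr t)^2"
      using sq[of a] sq[of b] assms by (simp add: S_def distrib_right)
    also have "a powr (1/t) / S + b powr (1/t) / S = 1"
      using False by (simp add: S_def add_divide_distrib[symmetric])
    finally show ?thesis by (simp add: S_def)
  qed
qed

lemma two_point_inequality:
  fixes a b c d s t :: real
  assumes st: "(s, t) \<in> pentagon" and nonneg: "0 \<le> a" "0 \<le> b" "0 \<le> c" "0 \<le> d"
  shows "(a * c)^2 + (a * d + b * c)^2 + (b * d)^2
    \<le> ((a powr (1/s) + b powr (1/s)) powr s * (c powr (1/t) + d powr (1/t)) powr t)^2"
proof (cases "a = 0 \<or> b = 0 \<or> c = 0 \<or> d = 0")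
  case True
  then have "(a * c)^2 + (a * d + b * c)^2 + (b * d)^2 = (a^2 + b^2) * (c^2 + d^2)"
    by (auto simp: algebra_simps power2_eq_square)
  also have "\<dots> \<le> ((a powr (1/s) + b powr (1/s)) powr s)^2 * ((c powr (1/t) + d powr (1/t)) powr t)^2"
    using pentagon_ge_half[OF st] nonneg by (intro mult_mono square_sum_le) auto
  finally show ?thesis by (simp add: power_mult_distrib)
next
  case False
  with nonneg have pos: "0 < a" "0 < b" "0 < c" "0 < d" by auto
  note half = pentagon_ge_half[OF st]
  define S where "S = a powr (1/s) + b powr (1/s)"
  define T where "T = c powr (1/t) + d powr (1/t)"
  define x y u v where "x = a powr (1/s) / S" and "y = b powr (1/s) / S"
    and "u = c powr (1/t) / T" and "v = d powr (1/t) / T"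
  have ST: "0 < S" "0 < T" using pos by (auto simp: S_def T_def add_pos_pos)
  have xy: "0 < x" "0 < y" "0 < u" "0 < v"
    using ST pos by (auto simp: x_def y_def u_def v_def)
  have "two_point_form x y u v (s, t) \<le> 1"
  proof (rule two_point_form_pentagon[OF _ _ _ _ _ _ st])
    show "x + y = 1" "u + v = 1"
      using ST by (simp_all add: x_def y_def u_def v_def S_def T_def add_divide_distrib[symmetric])
  qed (rule xy)+
  moreover have "x powr s = a / S powr s" "y powr s = b / S powr s"
      "u powr t = c / T powr t" "v powr t = d / T powr t"
    using pos ST half by (simp_all add: x_def y_def u_def v_def powr_divide powr_powr)
  ultimately have le: "((a / S powr s)^2 + (b / S powr s)^2) * ((c / T powr t)^2 + (d / T powr t)^2)
      + 2 * (a / S powr s * (b / S powr s)) * (c / T powr t * (d / T powr t)) \<le> 1"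
  proof -
    assume *: "two_point_form x y u v (s, t) \<le> 1"
      "x powr s = a / S powr s" "y powr s = b / S powr s"
      "u powr t = c / T powr t" "v powr t = d / T powr t"
    have "two_point_form x y u v (s, t) = ((x powr s)^2 + (y powr s)^2) * ((u powr t)^2 + (v powr t)^2)
        + 2 * (x powr s * y powr s) * (u powr t * v powr t)"
      using xy by (simp add: two_point_form_def powr_double powr_mult)
    then show ?thesis using *(1) unfolding *(2-) by (rule subst)
  qed
  have "((a * c)^2 + (a * d + b * c)^2 + (b * d)^2) / (S powr s * T powr t)^2 \<le> 1"
  proof -
    define M N where "M = S powr s" and "N = T powr t"
    have MN: "M > 0" "N > 0" using ST by (simp_all add: M_def N_def)
    define a' b' c' d' where "a' = a / M" and "b' = b / M" and "c' = c / N" and "d' = d / N"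
    have abcd: "a = a' * M" "b = b' * M" "c = c' * N" "d = d' * N"
      using MN by (simp_all add: a'_def b'_def c'_def d'_def)
    have "(a * c)^2 + (a * d + b * c)^2 + (b * d)^2
      = ((a'^2 + b'^2) * (c'^2 + d'^2) + 2 * (a' * b') * (c' * d')) * (M * N)^2"
      unfolding abcd by algebra
    moreover have "(M * N)^2 \<noteq> 0" using MN by simp
    ultimately
    have "((a * c)^2 + (a * d + b * c)^2 + (b * d)^2) / (M * N)^2
      = ((a / M)^2 + (b / M)^2) * ((c / N)^2 + (d / N)^2) + 2 * (a / M * (b / M)) * (c / N * (d / N))"
      unfolding a'_def b'_def c'_def d'_def by simp
    then show ?thesis using le unfolding M_def N_def by simp
  qed
  then show ?thesis using ST by (simp add: S_def T_def divide_le_eq)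
qed

section \<open>Boxes in the integer lattice\<close>

text \<open>
  The product of the sets \<open>S i\<close>, as a set of vectors.
\<close>

definition box_set :: "('d \<Rightarrow> int set) \<Rightarrow> (int ^ 'd) set" where
  "box_set S = {x. \<forall>i. x $ i \<in> S i}"

lemma box_set_eq_image_PiE: "box_set S = vec_lambda ` PiE UNIV S" for S :: "'d::finite \<Rightarrow> int set"
proof -
  have "x \<in> vec_lambda ` PiE UNIV S" if "x \<in> box_set S" for x
    using that by (intro image_eqI[of _ _ "vec_nth x"]) (auto simp: box_set_def)
  then show ?thesis by (auto simp: box_set_def)
qed

lemma finite_box_set: "(\<And>i. finite (S i)) \<Longrightarrow> finite (box_set S)" for S :: "'d::finite \<Rightarrow> int set"
  by (simp add: box_set_eq_image_PiE finite_PiE)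

lemma sum_box_set_prod:
  fixes h :: "'d::finite \<Rightarrow> int \<Rightarrow> real"
  assumes "\<And>i. finite (S i)"
  shows "(\<Sum>x\<in>box_set S. \<Prod>i\<in>UNIV. h i (x $ i)) = (\<Prod>i\<in>UNIV. \<Sum>a\<in>S i. h i a)"
proof -
  have "inj_on vec_lambda (PiE UNIV S)" by (rule inj_onI) (simp add: vec_lambda_inject)
  then have "(\<Sum>x\<in>box_set S. \<Prod>i\<in>UNIV. h i (x $ i)) = (\<Sum>\<phi>\<in>PiE UNIV S. \<Prod>i\<in>UNIV. h i (\<phi> i))"
    by (simp add: box_set_eq_image_PiE sum.reindex)
  also have "\<dots> = (\<Prod>i\<in>UNIV. \<Sum>a\<in>S i. h i a)"
    using assms by (simp add: prod_sum_PiE)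
  finally show ?thesis .
qed

text \<open>
  The face \<open>{0,1}\<^sup>D\<close> of the unit cube on which the coordinates outside \<open>D\<close> vanish. Induction on
  \<open>D\<close> replaces induction on the dimension.
\<close>

definition subcube :: "'d set \<Rightarrow> (int ^ 'd) set" where
  "subcube D = box_set (\<lambda>i. if i \<in> D then {0, 1} else {0})"

lemma finite_subcube: "finite (subcube D)" for D :: "'d::finite set"
  unfolding subcube_def by (rule finite_box_set) simp

lemma subcube_empty: "subcube {} = {0}"
  by (auto simp: subcube_def box_set_def vec_eq_iff)

lemma subcube_insert:
  fixes D :: "'d::finite set"
  assumes "i \<notin> D"
  shows "subcube (insert i D) = subcube D \<union> (\<lambda>x. x + axis i 1) ` subcube D"
proof (intro equalityI subsetI)
  fix x assume x: "x \<in> subcube (insert i D)"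
  then have "x $ i = 0 \<or> x $ i = 1" by (auto simp: subcube_def box_set_def split: if_splits)
  then show "x \<in> subcube D \<union> (\<lambda>x. x + axis i 1) ` subcube D"
  proof
    assume "x $ i = 0"
    then have "x \<in> subcube D" using x assms by (auto simp: subcube_def box_set_def split: if_splits)
    then show ?thesis by simp
  next
    assume "x $ i = 1"
    then have "x - axis i 1 \<in> subcube D"
      using x assms by (auto simp: subcube_def box_set_def axis_def split: if_splits)
    then show ?thesis by (intro UnI2 image_eqI[of _ _ "x - axis i 1"]) auto
  qed
next
  fix x assume "x \<in> subcube D \<union> (\<lambda>x. x + axis i 1) ` subcube D"
  then show "x \<in> subcube (insert i D)"
    using assms by (auto simp: subcube_def box_set_def axis_def split: if_splits)
qed

lemma sum_subcube_insert:
  fixes D :: "'d::finite set" and h :: "int ^ 'd \<Rightarrow> real"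
  assumes "i \<notin> D"
  shows "sum h (subcube (insert i D)) = sum h (subcube D) + (\<Sum>x\<in>subcube D. h (x + axis i 1))"
proof -
  have "x $ i = 0" if "x \<in> subcube D" for x
    using that assms by (auto simp: subcube_def box_set_def split: if_splits)
  then have "(x + axis i 1) $ i \<noteq> y $ i" if "x \<in> subcube D" "y \<in> subcube D" for x y
    using that by simp
  then have "subcube D \<inter> (\<lambda>x. x + axis i 1) ` subcube D = {}" by blast
  then have "sum h (subcube (insert i D)) = sum h (subcube D) + sum h ((\<lambda>x. x + axis i 1) ` subcube D)"
    unfolding subcube_insert[OF assms] by (intro sum.union_disjoint finite_imageI finite_subcube)
  also have "sum h ((\<lambda>x. x + axis i 1) ` subcube D) = (\<Sum>x\<in>subcube D. h (x + axis i 1))"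
    by (subst sum.reindex) (auto intro: inj_onI)
  finally show ?thesis .
qed

section \<open>Tensorization\<close>

text \<open>
  The convolution of the restrictions of \<open>f\<close> and \<open>g\<close> to the finite set \<open>A\<close>. The functions
  themselves need not be supported in \<open>A\<close>.
\<close>

definition conv_on :: "(int ^ 'd) set \<Rightarrow> (int ^ 'd \<Rightarrow> real) \<Rightarrow> (int ^ 'd \<Rightarrow> real) \<Rightarrow> int ^ 'd \<Rightarrow> real" where
  "conv_on A f g z = (\<Sum>x\<in>A. \<Sum>y\<in>A. if x + y = z then f x * g y else 0)"

text \<open>
  The \<open>\<ell>\<^sup>p\<close> norm on the finite set \<open>A\<close>, in terms of \<open>s = 1/p\<close>.
\<close>

definition norm_on :: "real \<Rightarrow> (int ^ 'd) set \<Rightarrow> (int ^ 'd \<Rightarrow> real) \<Rightarrow> real" where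
  "norm_on s A f = (\<Sum>x\<in>A. \<bar>f x\<bar> powr (1/s)) powr s"

lemma conv_on_subcube_eq_0:
  fixes D :: "'d::finite set"
  assumes "i \<notin> D" "z $ i \<noteq> 0"
  shows "conv_on (subcube D) f g z = 0"
proof -
  have "x + y \<noteq> z" if "x \<in> subcube D" "y \<in> subcube D" for x y
  proof -
    have "x $ i = 0" "y $ i = 0"
      using that assms by (auto simp: subcube_def box_set_def split: if_splits)
    then show ?thesis using assms(2) by auto
  qed
  then show ?thesis by (simp add: conv_on_def)
qed

lemma conv_on_subcube_insert:
  fixes D :: "'d::finite set" and f g :: "int ^ 'd \<Rightarrow> real"
  assumes "i \<notin> D"
  defines "A \<equiv> subcube D" and "e \<equiv> axis i 1"
    and "f' \<equiv> \<lambda>x. f (x + axis i 1)" and "g' \<equiv> \<lambda>x. g (x + axis i 1)"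
  shows "conv_on (subcube (insert i D)) f g z
    = conv_on A f g z + (conv_on A f g' (z - e) + conv_on A f' g (z - e)) + conv_on A f' g' (z - e - e)"
proof -
  have "x + (y + e) = z \<longleftrightarrow> x + y = z - e" "x + e + y = z \<longleftrightarrow> x + y = z - e"
    "x + e + (y + e) = z \<longleftrightarrow> x + y = z - e - e" for x y :: "int ^ 'd"
    by (auto simp: algebra_simps)
  then show ?thesis
    unfolding conv_on_def sum_subcube_insert[OF assms(1)] f'_def g'_def A_def e_def[symmetric]
    by (simp add: sum.distrib)
qed

lemma L2_set_shift: "L2_set (\<lambda>z. h (z - e)) Z = L2_set h ((\<lambda>z. z - e) ` Z)"
  for e :: "'a::ab_group_add"
  unfolding L2_set_def by (subst sum.reindex) (auto intro: inj_onI)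

lemma norm_on_subcube_insert:
  fixes D :: "'d::finite set"
  assumes "i \<notin> D" "s \<noteq> 0"
  shows "norm_on s (subcube (insert i D)) f =
    (norm_on s (subcube D) f powr (1/s) + norm_on s (subcube D) (\<lambda>x. f (x + axis i 1)) powr (1/s)) powr s"
  using assms by (simp add: norm_on_def sum_subcube_insert powr_powr sum_nonneg)

text \<open>
  The set \<open>Z\<close> is arbitrary, which leaves the induction hypothesis applicable to the translates
  of \<open>Z\<close> by multiples of a unit vector.
\<close>

lemma L2_set_conv_on_subcube_le:
  fixes D :: "'d::finite set"
  assumes st: "(s, t) \<in> pentagon" and "finite Z"
  shows "L2_set (conv_on (subcube D) f g) Z \<le> norm_on s (subcube D) f * norm_on t (subcube D) g"
proof -
  have st0: "s \<noteq> 0" "t \<noteq> 0" using pentagon_ge_half[OF st] by auto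
  have "finite D" by simp
  then show ?thesis using \<open>finite Z\<close>
  proof (induction D arbitrary: f g Z rule: finite_induct)
    case empty
    have "L2_set (conv_on (subcube {}) f g) Z = (if 0 \<in> Z then \<bar>f 0 * g 0\<bar> else 0)"
    proof -
      have "(conv_on (subcube {}) f g z)^2 = (if z = 0 then (f 0 * g 0)^2 else 0)" for z
        by (simp add: conv_on_def subcube_empty)
      then show ?thesis using empty by (simp add: L2_set_def sum.delta)
    qed
    also have "\<dots> \<le> \<bar>f 0\<bar> * \<bar>g 0\<bar>" by (simp add: abs_mult)
    also have "\<dots> = norm_on s (subcube {}) f * norm_on t (subcube {}) g"
      using st0 by (simp add: norm_on_def subcube_empty powr_powr)
    finally show ?case .
  next
    case (insert i D)
    define e :: "int ^ 'd" where "e = axis i 1"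
    define f' g' where "f' = (\<lambda>x. f (x + e))" and "g' = (\<lambda>x. g (x + e))"
    define N where "N = (\<lambda>s. norm_on s (subcube D))"
    define C where "C = conv_on (subcube D)"
    have N0: "0 \<le> N r h" for r h by (simp add: N_def norm_on_def)
    have IH: "L2_set (C h k) W \<le> N s h * N t k" if "finite W" for h k W
      unfolding C_def N_def using insert.IH[OF that] .
    let ?P = "C f g" and ?Q = "\<lambda>z. C f g' z + C f' g z" and ?R = "C f' g'"
    let ?Z1 = "(\<lambda>z. z - e) ` Z" and ?Z2 = "(\<lambda>z. z - e) ` (\<lambda>z. z - e) ` Z"
    have fin: "finite ?Z1" "finite ?Z2" using insert.prems by auto
    have conv: "conv_on (subcube (insert i D)) f g z = ?P z + ?Q (z - e) + ?R (z - e - e)" for z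
      unfolding C_def f'_def g'_def e_def by (rule conv_on_subcube_insert[OF insert.hyps(2)])
    have zero: "C h k z = 0" if "z $ i \<noteq> 0" for h k z
      unfolding C_def by (rule conv_on_subcube_eq_0[OF insert.hyps(2) that])
    \<comment> \<open>The three summands live on \<open>z $ i = 0\<close>, \<open>z $ i = 1\<close> and \<open>z $ i = 2\<close>.\<close>
    have sq: "(conv_on (subcube (insert i D)) f g z)^2 = (?P z)^2 + (?Q (z - e))^2 + (?R (z - e - e))^2" for z
      unfolding conv
      by (cases "z $ i = 0"; cases "z $ i = 1") (simp_all add: zero e_def)
    have "(L2_set (conv_on (subcube (insert i D)) f g) Z)^2
        = (L2_set ?P Z)^2 + (L2_set (\<lambda>z. ?Q (z - e)) Z)^2 + (L2_set (\<lambda>z. ?R (z - e - e)) Z)^2"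
      by (simp add: L2_set_def sq sum.distrib sum_nonneg)
    also have "L2_set (\<lambda>z. ?Q (z - e)) Z = L2_set ?Q ?Z1" by (rule L2_set_shift)
    also have "L2_set (\<lambda>z. ?R (z - e - e)) Z = L2_set ?R ?Z2"
      using L2_set_shift[of "\<lambda>z. ?R (z - e)" e Z] L2_set_shift[of ?R e ?Z1] by simp
    also have "(L2_set ?P Z)^2 + (L2_set ?Q ?Z1)^2 + (L2_set ?R ?Z2)^2
        \<le> (N s f * N t g)^2 + (N s f * N t g' + N s f' * N t g)^2 + (N s f' * N t g')^2"
    proof (intro add_mono power_mono)
      show "L2_set ?Q ?Z1 \<le> N s f * N t g' + N s f' * N t g"
        using L2_set_triangle_ineq[of "C f g'" "C f' g" ?Z1] IH[OF fin(1), of f g'] IH[OF fin(1), of f' g]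
        by linarith
    qed (use IH insert.prems fin in auto)
    also have "\<dots> \<le> ((N s f powr (1/s) + N s f' powr (1/s)) powr s * (N t g powr (1/t) + N t g' powr (1/t)) powr t)^2"
      by (rule two_point_inequality[OF st N0 N0 N0 N0])
    also have "\<dots> = (norm_on s (subcube (insert i D)) f * norm_on t (subcube (insert i D)) g)^2"
      unfolding norm_on_subcube_insert[OF insert.hyps(2) st0(1)] norm_on_subcube_insert[OF insert.hyps(2) st0(2)]
      by (simp add: N_def f'_def g'_def e_def)
    finally show ?case by (rule power2_le_imp_le) (simp add: norm_on_def)
  qed
qed

section \<open>Passage to the norms on the whole lattice\<close>

lemma infsum_eq_sum:
  fixes f :: "'a \<Rightarrow> real"
  assumes "finite A" "\<And>x. x \<notin> A \<Longrightarrow> f x = 0"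
  shows "infsum f UNIV = sum f A"
proof -
  have "infsum f UNIV = infsum f A" by (rule infsum_cong_neutral) (use assms in auto)
  then show ?thesis using assms by simp
qed

lemma supported_in_cube_iff: "supported_in_cube f \<longleftrightarrow> (\<forall>x. x \<notin> subcube UNIV \<longrightarrow> f x = 0)"
  by (simp add: supported_in_cube_def subcube_def box_set_def)

lemma conv_eq_conv_on:
  fixes f g :: "int ^ 'd \<Rightarrow> real"
  assumes "supported_in_cube f" "supported_in_cube g"
  shows "conv f g = conv_on (subcube UNIV) f g"
proof
  fix z
  have "conv f g z = (\<Sum>x\<in>subcube UNIV. f x * g (z - x))"
    unfolding conv_def using assms(1)
    by (intro infsum_eq_sum finite_subcube) (simp add: supported_in_cube_iff)
  also have "\<dots> = conv_on (subcube UNIV) f g z"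
    unfolding conv_on_def
  proof (rule sum.cong[OF refl])
    fix x :: "int ^ 'd"
    have "(\<Sum>y\<in>subcube UNIV. if x + y = z then f x * g y else 0)
        = (\<Sum>y\<in>subcube UNIV. if y = z - x then f x * g y else 0)"
      by (intro sum.cong) (auto simp: algebra_simps)
    also have "\<dots> = f x * g (z - x)"
      using assms(2) by (simp add: finite_subcube supported_in_cube_iff)
    finally show "f x * g (z - x) = (\<Sum>y\<in>subcube UNIV. if x + y = z then f x * g y else 0)" by simp
  qed
  finally show "conv f g z = conv_on (subcube UNIV) f g z" .
qed

lemma lp_norm_2_conv:
  fixes f g :: "int ^ 'd \<Rightarrow> real"
  assumes "supported_in_cube f" "supported_in_cube g"
  shows "lp_norm 2 (conv f g) = L2_set (conv f g) (box_set (\<lambda>_. {0, 1, 2}))"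
proof -
  let ?B = "box_set (\<lambda>_. {0, 1, 2}) :: (int ^ 'd) set"
  have zero: "conv f g z = 0" if "z \<notin> ?B" for z
  proof -
    have "x + y \<noteq> z" if "x \<in> subcube UNIV" "y \<in> subcube UNIV" for x y
    proof
      assume z: "x + y = z"
      have "z $ i \<in> {0, 1, 2}" for i
      proof -
        have "x $ i = 0 \<or> x $ i = 1" "y $ i = 0 \<or> y $ i = 1"
          using that by (auto simp: subcube_def box_set_def)
        then show ?thesis unfolding z[symmetric] by auto
      qed
      then show False using \<open>z \<notin> ?B\<close> by (simp add: box_set_def)
    qed
    then show ?thesis unfolding conv_eq_conv_on[OF assms] by (simp add: conv_on_def)
  qed
  have "(\<Sum>\<^sub>\<infinity>z. \<bar>conv f g z\<bar> powr 2) = (\<Sum>z\<in>?B. \<bar>conv f g z\<bar> powr 2)"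
    by (intro infsum_eq_sum finite_box_set) (auto simp: zero)
  then show ?thesis
    by (simp add: lp_norm_def L2_set_def powr_half_sqrt sum_nonneg)
qed

lemma recip_eq:
  assumes "1 \<le> p" "p \<noteq> \<infinity>"
  shows "recip p = 1 / enn2real p" "1 \<le> enn2real p"
proof -
  obtain r where r: "p = ennreal r" "0 \<le> r" using assms(2) by (cases p) auto
  with assms(1) have "1 \<le> r" by (simp add: ennreal_1[symmetric] del: ennreal_1)
  then show "recip p = 1 / enn2real p" "1 \<le> enn2real p"
    using r by (simp_all add: recip_def divide_ennreal ennreal_1[symmetric] del: ennreal_1)
qed

lemma recip_infinity: "recip \<infinity> = 0"
  by (simp add: recip_def)

lemma lp_norm_eq_norm_on:
  fixes f :: "int ^ 'd \<Rightarrow> real"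
  assumes "supported_in_cube f" "1 \<le> p" "p \<noteq> \<infinity>"
  shows "lp_norm p f = norm_on (recip p) (subcube UNIV) f"
proof -
  note r = recip_eq[OF assms(2,3)]
  have "(\<Sum>\<^sub>\<infinity>x. \<bar>f x\<bar> powr enn2real p) = (\<Sum>x\<in>subcube UNIV. \<bar>f x\<bar> powr enn2real p)"
    using assms(1) r(2) by (intro infsum_eq_sum finite_subcube) (simp add: supported_in_cube_iff)
  then show ?thesis using assms(3) by (simp add: lp_norm_def norm_on_def r(1))
qed

section \<open>Counterexamples\<close>

text \<open>
  The indicator function of the unit cube.
\<close>

definition cube_indicator :: "int ^ 'd \<Rightarrow> real" where
  "cube_indicator = indicator (subcube UNIV)"

text \<open>
  The unit mass at the origin, the neutral element of convolution.
\<close>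

definition delta :: "int ^ 'd \<Rightarrow> real" where
  "delta = indicator {0}"

lemma supported_cube_indicator: "supported_in_cube cube_indicator"
  by (simp add: supported_in_cube_iff cube_indicator_def)

lemma supported_delta: "supported_in_cube delta"
  by (auto simp: supported_in_cube_def delta_def indicator_def)

lemma conv_delta: "conv f delta = f"
proof
  fix z
  have "conv f delta z = (\<Sum>y\<in>{z}. f y * delta (z - y))"
    unfolding conv_def by (rule infsum_eq_sum) (auto simp: delta_def)
  then show "conv f delta z = f z" by (simp add: delta_def)
qed

lemma lp_norm_indicator:
  fixes A :: "(int ^ 'd) set"
  assumes "A \<subseteq> subcube UNIV" "A \<noteq> {}" "1 \<le> p"
  shows "lp_norm p (indicator A) = card A powr recip p"
proof (cases "p = \<infinity>")
  case True
  have "finite A" using assms(1) finite_subcube finite_subset by blast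
  have "(SUP x. \<bar>indicator A x :: real\<bar>) = 1"
  proof (rule cSup_eq_maximum)
    obtain a where "a \<in> A" using assms(2) by blast
    then show "1 \<in> range (\<lambda>x. \<bar>indicator A x :: real\<bar>)" by (intro image_eqI[of _ _ a]) auto
  qed (auto simp: indicator_def)
  then show ?thesis using True assms(2) \<open>finite A\<close> by (simp add: lp_norm_def recip_infinity[simplified])
next
  case False
  have fin: "finite A" using assms(1) finite_subcube finite_subset by blast
  have "supported_in_cube (indicator A)"
    using assms(1) by (auto simp: supported_in_cube_iff indicator_def)
  moreover have "(\<Sum>x\<in>subcube UNIV. \<bar>indicator A x :: real\<bar> powr (1 / recip p)) = card A"
  proof -
    have "(\<Sum>x\<in>subcube UNIV. \<bar>indicator A x :: real\<bar> powr (1 / recip p)) = (\<Sum>x\<in>subcube UNIV. indicator A x)"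
      by (intro sum.cong) (auto simp: indicator_def)
    also have "\<dots> = card A"
      using assms(1) finite_subcube by (subst sum.mono_neutral_cong_right[of _ A _ "\<lambda>_. 1"]) auto
    finally show ?thesis .
  qed
  ultimately show ?thesis using assms(3) False
    by (simp add: lp_norm_eq_norm_on norm_on_def)
qed

lemma card_subcube_UNIV: "card (subcube UNIV :: (int ^ 'd) set) = 2 ^ CARD('d)"
proof -
  have "real (card (subcube UNIV :: (int ^ 'd) set)) = 2 ^ CARD('d)"
    using sum_box_set_prod[of "\<lambda>_ :: 'd. {0, 1}" "\<lambda>_ _. 1"] by (simp add: subcube_def)
  then show ?thesis by (metis of_nat_eq_iff of_nat_numeral of_nat_power)
qed

lemma lp_norm_cube_indicator:
  assumes "1 \<le> p"
  shows "lp_norm p (cube_indicator :: int ^ 'd \<Rightarrow> real) = (2 powr recip p) ^ CARD('d)"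
proof -
  have "0 \<in> (subcube UNIV :: (int ^ 'd) set)" by (simp add: subcube_def box_set_def)
  then have "lp_norm p (cube_indicator :: int ^ 'd \<Rightarrow> real) = (2 ^ CARD('d)) powr recip p"
    unfolding cube_indicator_def using assms
    by (subst lp_norm_indicator) (auto simp: card_subcube_UNIV)
  also have "\<dots> = (2 powr recip p) ^ CARD('d)"
    by (simp add: powr_realpow[symmetric] powr_powr mult.commute)
  finally show ?thesis .
qed

lemma lp_norm_delta: "1 \<le> p \<Longrightarrow> lp_norm p delta = 1"
  unfolding delta_def by (subst lp_norm_indicator) (auto simp: subcube_def box_set_def)

lemma lp_norm_2_conv_cube_indicator:
  "lp_norm 2 (conv cube_indicator cube_indicator :: int ^ 'd \<Rightarrow> real) = sqrt 6 ^ CARD('d)"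
proof -
  \<comment> \<open>The one-dimensional convolution of the indicator of \<open>{0, 1}\<close> with itself, with values \<open>1, 2, 1\<close>.\<close>
  define h :: "int \<Rightarrow> real" where "h c = (\<Sum>a\<in>{0, 1}. indicator {0, 1} (c - a))" for c
  have conv: "conv cube_indicator cube_indicator z = (\<Prod>i\<in>UNIV. h (z $ i))" for z :: "int ^ 'd"
  proof -
    have "conv cube_indicator cube_indicator z
        = (\<Sum>x\<in>subcube UNIV. cube_indicator x * cube_indicator (z - x))"
      unfolding conv_def by (intro infsum_eq_sum finite_subcube) (simp add: cube_indicator_def)
    also have "\<dots> = (\<Sum>x\<in>box_set (\<lambda>_. {0, 1}). \<Prod>i\<in>UNIV. indicator {0, 1} (z $ i - x $ i))"
    proof (rule sum.cong)
      fix x :: "int ^ 'd" assume "x \<in> box_set (\<lambda>_. {0, 1})"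
      then have "cube_indicator x * cube_indicator (z - x) = indicator (box_set (\<lambda>_. {0, 1})) (z - x)"
        by (simp add: cube_indicator_def subcube_def)
      also have "\<dots> = (\<Prod>i\<in>UNIV. indicator {0, 1} (z $ i - x $ i))"
      proof (cases "z - x \<in> box_set (\<lambda>_. {0, 1})")
        case True
        then have "indicator {0, 1} (z $ i - x $ i) = (1::real)" for i by (simp add: box_set_def)
        then show ?thesis using True by simp
      next
        case False
        then obtain i where "z $ i - x $ i \<notin> {0, 1}" by (auto simp: box_set_def)
        then have "indicator {0, 1} (z $ i - x $ i) = (0::real)" by (simp add: indicator_def)
        then have "(\<Prod>i\<in>UNIV. indicator {0, 1} (z $ i - x $ i)) = (0::real)" by (intro prod_zero) auto
        then show ?thesis using False by simp
      qed
      finally show "cube_indicator x * cube_indicator (z - x) = (\<Prod>i\<in>UNIV. indicator {0, 1} (z $ i - x $ i))" .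
    qed (simp add: subcube_def)
    also have "\<dots> = (\<Prod>i\<in>UNIV. h (z $ i))"
      unfolding h_def by (rule sum_box_set_prod) simp
    finally show ?thesis .
  qed
  have h: "h 0 = 1" "h 1 = 2" "h 2 = 1" by (simp_all add: h_def)
  have "(\<Sum>z\<in>box_set (\<lambda>_. {0, 1, 2}). (\<Prod>i\<in>UNIV. h ((z :: int ^ 'd) $ i))^2) = 6 ^ CARD('d)"
    using sum_box_set_prod[of "\<lambda>_ :: 'd. {0, 1, 2}" "\<lambda>_ c. (h c)^2"]
    by (simp add: prod_power_distrib h)
  then show ?thesis
    unfolding lp_norm_2_conv[OF supported_cube_indicator supported_cube_indicator]
    by (simp add: L2_set_def conv real_sqrt_power)
qed

lemma failure_cube_indicators:
  assumes "1 \<le> p" "1 \<le> q" "recip p + recip q < log 2 6 / 2"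
  shows "lp_norm p (cube_indicator :: int ^ 'd \<Rightarrow> real) * lp_norm q (cube_indicator :: int ^ 'd \<Rightarrow> real)
    < lp_norm 2 (conv cube_indicator cube_indicator :: int ^ 'd \<Rightarrow> real)"
proof -
  have "lp_norm p (cube_indicator :: int ^ 'd \<Rightarrow> real) * lp_norm q (cube_indicator :: int ^ 'd \<Rightarrow> real)
      = (2 powr (recip p + recip q)) ^ CARD('d)"
    using assms by (simp add: lp_norm_cube_indicator powr_add power_mult_distrib)
  also have "\<dots> < sqrt 6 ^ CARD('d)"
  proof (rule power_strict_mono)
    have "2 powr (recip p + recip q) < 2 powr (log 2 6 * (1/2))" using assms(3) by simp
    also have "\<dots> = sqrt 6" by (simp only: powr_powr[symmetric]) (simp add: powr_half_sqrt)
    finally show "2 powr (recip p + recip q) < sqrt 6" .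
  qed auto
  finally show ?thesis by (simp add: lp_norm_2_conv_cube_indicator)
qed

lemma failure_cube_indicator_delta:
  assumes "1 \<le> p" "1 \<le> q" "recip p < 1/2"
  shows "lp_norm p (cube_indicator :: int ^ 'd \<Rightarrow> real) * lp_norm q (delta :: int ^ 'd \<Rightarrow> real)
    < lp_norm 2 (cube_indicator :: int ^ 'd \<Rightarrow> real)"
proof -
  have two: "recip 2 = 1/2" "1 \<le> (2::ennreal)" using recip_eq[of 2] by auto
  have "(2 powr recip p) ^ CARD('d) < (2 powr (1/2)) ^ CARD('d)"
    using assms by (intro power_strict_mono) auto
  then show ?thesis using assms two(2) by (simp add: lp_norm_cube_indicator lp_norm_delta two(1))
qed

lemma conv_commute: "conv f g = conv g f"
proof
  fix z
  have "(\<Sum>\<^sub>\<infinity>y. f y * g (z - y)) = (\<Sum>\<^sub>\<infinity>y. f (z - y) * g (z - (z - y)))"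
    by (rule infsum_reindex_bij_betw[symmetric, of "\<lambda>y. z - y"]) (rule bij_betw_byWitness[where f' = "\<lambda>y. z - y"], auto)
  then show "conv f g z = conv g f z" by (simp add: conv_def mult.commute)
qed

section \<open>The convolution inequality and its failure\<close>

theorem corollary1p5:
  fixes p q :: ennreal
  assumes "1 \<le> p" and "1 \<le> q"
  shows
    "((recip p, recip q) \<in> pentagon \<longrightarrow>
        (\<forall>f g :: int ^ 'd \<Rightarrow> real. supported_in_cube f \<longrightarrow> supported_in_cube g \<longrightarrow>
          lp_norm 2 (conv f g) \<le> lp_norm p f * lp_norm q g)) \<and>
     (recip p + recip q < log 2 6 / 2 \<or> min (recip p) (recip q) < 1/2 \<longrightarrow>
        (\<exists>f g :: int ^ 'd \<Rightarrow> real. supported_in_cube f \<and> supported_in_cube g \<and>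
          \<not> lp_norm 2 (conv f g) \<le> lp_norm p f * lp_norm q g))"
proof (intro conjI impI allI)
  fix f g :: "int ^ 'd \<Rightarrow> real"
  assume pq: "(recip p, recip q) \<in> pentagon" and supp: "supported_in_cube f" "supported_in_cube g"
  \<comment> \<open>In the pentagon both coordinates are positive, whereas \<open>recip \<infinity> = 0\<close>.\<close>
  have fin: "p \<noteq> \<infinity>" "q \<noteq> \<infinity>" using pentagon_ge_half[OF pq] recip_infinity by auto
  show "lp_norm 2 (conv f g) \<le> lp_norm p f * lp_norm q g"
    unfolding lp_norm_2_conv[OF supp, unfolded conv_eq_conv_on[OF supp]] conv_eq_conv_on[OF supp]
      lp_norm_eq_norm_on[OF supp(1) assms(1) fin(1)] lp_norm_eq_norm_on[OF supp(2) assms(2) fin(2)]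
    by (rule L2_set_conv_on_subcube_le[OF pq finite_box_set]) simp
next
  assume "recip p + recip q < log 2 6 / 2 \<or> min (recip p) (recip q) < 1/2"
  then consider "recip p + recip q < log 2 6 / 2" | "recip p < 1/2" | "recip q < 1/2" by linarith
  then show "\<exists>f g :: int ^ 'd \<Rightarrow> real. supported_in_cube f \<and> supported_in_cube g \<and>
      \<not> lp_norm 2 (conv f g) \<le> lp_norm p f * lp_norm q g"
  proof cases
    case 1
    then show ?thesis
      using failure_cube_indicators[OF assms] supported_cube_indicator not_le by blast
  next
    case 2
    then have "\<not> lp_norm 2 (conv cube_indicator delta :: int ^ 'd \<Rightarrow> real)
        \<le> lp_norm p (cube_indicator :: int ^ 'd \<Rightarrow> real) * lp_norm q (delta :: int ^ 'd \<Rightarrow> real)"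
      using failure_cube_indicator_delta[where 'd = 'd, OF assms] by (simp add: conv_delta not_le)
    then show ?thesis using supported_cube_indicator supported_delta by blast
  next
    case 3
    then have "\<not> lp_norm 2 (conv delta cube_indicator :: int ^ 'd \<Rightarrow> real)
        \<le> lp_norm p (delta :: int ^ 'd \<Rightarrow> real) * lp_norm q (cube_indicator :: int ^ 'd \<Rightarrow> real)"
      using failure_cube_indicator_delta[where 'd = 'd, OF assms(2,1)]
      by (simp add: conv_commute[of delta] conv_delta not_le mult.commute)
    then show ?thesis using supported_cube_indicator supported_delta by blast
  qed
qed

end
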